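(* Let $n \ge 4$ and let $f \colon \mathbb{Z}_3^n \to \mathbb{Z}_3$ be a function depending on all of its $n$ variables. Then $\operatorname{gap} f = 2$ if and only if there exist a unary polynomial $p(x) = ax^2 + bx + c \in \mathbb{Z}_3[x]$ and a constant $d \in \mathbb{Z}_3$ such that for all $\mathbf{x} = (x_1,\dots,x_n) \in \mathbb{Z}_3^n$: \begin{align*} f(\mathbf{x}) &= \bigoplus_{1 \le i < j \le n} \bigl( (x_i - x_j)^2 p(x_i + x_j) + d \bigr) \oplus d && \text{if } n \equiv 0 \pmod 4,\\ f(\mathbf{x}) &= \bigoplus_{1 \le i < j \le n} \bigl( (x_i - x_j)^2 p(x_i + x_j) + d \bigr) \oplus \bigoplus_{i=1}^n \bigl( p(x_i) + d \bigr) && \text{if } n \equiv 1 \pmod 4,\\ f(\mathbf{x}) &= \bigoplus_{1 \le i < j \le n} \bigl( (x_i - x_j)^2 p(x_i + x_j) + d \bigr) && \text{if } n \equiv 2 \pmod 4,\\ f(\mathbf{x}) &= \bigoplus_{1 \le i < j \le n} \bigl( (x_i - x_j)^2 p(x_i + x_j) + d \bigr) \oplus \bigoplus_{i=1}^n \bigl( p(x_i) + d \bigr) \oplus d && \text{if } n \equiv 3 \pmod 4; \end{align*} moreover, in that case $p$ (i.e. $a,b,c$) and $d$ are uniquely determined by $f$. Otherwise $\operatorname{gap} f = 1$.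
   Context: $+$, $-$ and multiplication are the field operations of $\mathbb{Z}_3 = \{0,1,2\}$. Each element $u \in \mathbb{Z}_3$ is identified with the singleton $\{u\}$ in the Boolean group $(\mathcal{P}(\mathbb{Z}_3); \oplus)$, where $\oplus$ is symmetric difference of sets; the expressions inside the parentheses are computed in $\mathbb{Z}_3$ and the results are combined with $\oplus$ (the equalities are asserted in $\mathcal{P}(\mathbb{Z}_3)$, where $f(\mathbf{x})$ is identified with $\{f(\mathbf{x})\}$). The $i$-th variable of $g \colon \mathbb{Z}_3^n \to \mathbb{Z}_3$ is essential if there are tuples differing only in the $i$-th coordinate on which $g$ takes different values; $\operatorname{Ess} g$ is the set of indices of essential variables and $\operatorname{ess} g = |\operatorname{Ess} g|$. For $i \ne j$, the identification minor $f_{i \leftarrow j}$ is $f_{i \leftarrow j}(x_1,\dots,x_n) = f(x_1,\dots,x_{i-1},x_j,x_{i+1},\dots,x_n)$. The arity gap of $f$ is $\operatorname{gap} f = \min_{i,j \in \operatorname{Ess} f,\, i \ne j} (\operatorname{ess} f - \operatorname{ess} f_{i \leftarrow j})$. *)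

theory Defs
  imports
    "HOL-Library.FuncSet"
    "HOL-Library.Numeral_Type"
    "HOL-Computational_Algebra.Polynomial"
begin

text \<open>
  The numeral type \<open>3\<close>, with arithmetic modulo 3, plays the role of \<open>\<int>\<^sub>3\<close>.
  An \<open>n\<close>-tuple over \<open>'a\<close> is an extensional function on \<open>{1..n}\<close>, and an \<open>n\<close>-ary
  function is a HOL function on \<open>nat \<Rightarrow> 'a\<close> of which only the values on \<open>tuples n\<close> matter.
\<close>

type_synonym z3 = 3

definition tuples :: "nat \<Rightarrow> (nat \<Rightarrow> 'a) set" where
  "tuples n = {1..n} \<rightarrow>\<^sub>E UNIV"

definition Ess :: "nat \<Rightarrow> ((nat \<Rightarrow> 'a) \<Rightarrow> 'b) \<Rightarrow> nat set" where
  "Ess n f = {i \<in> {1..n}. \<exists>x \<in> tuples n. \<exists>y \<in> tuples n.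
      (\<forall>k \<in> {1..n} - {i}. x k = y k) \<and> f x \<noteq> f y}"

definition ess :: "nat \<Rightarrow> ((nat \<Rightarrow> 'a) \<Rightarrow> 'b) \<Rightarrow> nat" where
  "ess n f = card (Ess n f)"

definition ident_minor ::
    "((nat \<Rightarrow> 'a) \<Rightarrow> 'b) \<Rightarrow> nat \<Rightarrow> nat \<Rightarrow> (nat \<Rightarrow> 'a) \<Rightarrow> 'b" where
  "ident_minor f i j = (\<lambda>x. f (x(i := x j)))"

text \<open>
  The minimum is over a nonempty set only if \<open>f\<close> has at least two essential variables.
  The differences are taken in \<open>int\<close>, so no truncation occurs.
\<close>

definition arity_gap :: "nat \<Rightarrow> ((nat \<Rightarrow> 'a) \<Rightarrow> 'b) \<Rightarrow> int" where
  "arity_gap n f =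
     Min {int (ess n f) - int (ess n (ident_minor f i j)) | i j.
            i \<in> Ess n f \<and> j \<in> Ess n f \<and> i \<noteq> j}"

definition symdiff :: "'a set \<Rightarrow> 'a set \<Rightarrow> 'a set" (infixl \<open>\<oplus>\<close> 65) where
  "A \<oplus> B = (A - B) \<union> (B - A)"

text \<open>
  \<open>Symdiff F I\<close> is the iterated symmetric difference of \<open>F i\<close> over \<open>i \<in> I\<close>, obtained from
  the commutative monoid \<open>(\<P>('a); \<oplus>, \<emptyset>)\<close> in the same way as \<^const>\<open>sum\<close> is from addition.
\<close>

global_interpretation Symdiff: comm_monoid_set symdiff "{}"
  defines Symdiff = Symdiff.F
  by unfold_locales (auto simp: symdiff_def)

definition quad_poly :: "z3 \<Rightarrow> z3 \<Rightarrow> z3 \<Rightarrow> z3 poly" where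
  "quad_poly a b c = [:c, b, a:]"

definition pair_part :: "nat \<Rightarrow> z3 poly \<Rightarrow> z3 \<Rightarrow> (nat \<Rightarrow> z3) \<Rightarrow> z3 set" where
  "pair_part n p d x =
     Symdiff (\<lambda>(i, j). {(x i - x j)\<^sup>2 * poly p (x i + x j) + d}) {(i, j). 1 \<le> i \<and> i < j \<and> j \<le> n}"

definition single_part :: "nat \<Rightarrow> z3 poly \<Rightarrow> z3 \<Rightarrow> (nat \<Rightarrow> z3) \<Rightarrow> z3 set" where
  "single_part n p d x = Symdiff (\<lambda>i. {poly p (x i) + d}) {1..n}"

definition has_form :: "nat \<Rightarrow> ((nat \<Rightarrow> z3) \<Rightarrow> z3) \<Rightarrow> z3 poly \<Rightarrow> z3 \<Rightarrow> bool" where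
  "has_form n f p d \<longleftrightarrow> (\<forall>x \<in> tuples n.
     (n mod 4 = 0 \<longrightarrow> {f x} = pair_part n p d x \<oplus> {d}) \<and>
     (n mod 4 = 1 \<longrightarrow> {f x} = pair_part n p d x \<oplus> single_part n p d x) \<and>
     (n mod 4 = 2 \<longrightarrow> {f x} = pair_part n p d x) \<and>
     (n mod 4 = 3 \<longrightarrow> {f x} = pair_part n p d x \<oplus> single_part n p d x \<oplus> {d}))"

end

theory Submission
  imports Defs
begin

text \<open>
  Since \<open>n \<ge> 4\<close> exceeds the number of values, \<open>f\<close> is determined by its identification minors.
  If the gap is at least two, then in each minor \<open>f\<^bsub>i\<leftarrow>j\<^esub>\<close> either the merged variable or some
  other variable \<open>x\<^sub>l\<close> is inessential. If \<open>x\<^sub>l\<close> is the only inessential one and the merged variable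
  is essential, comparing minors makes a variable of \<open>f\<close> inessential. Otherwise a variable can
  be turned into a parameter, down to four variables, and it follows that the merged variable
  is always inessential. Then a pair of equal entries may be replaced by any other pair of equal
  entries, so that \<open>f\<close> depends only on the parities of the numbers of occurrences of \<open>0, 1, 2\<close>.
  For given \<open>n\<close> these parities take four values, and so do the right-hand sides of the four
  formulas, at which they equal \<open>d\<close> and \<open>p(v) + d\<close> for \<open>v = 0, 1, 2\<close>.
\<close>

section \<open>Inessential variables of identification minors\<close>

lemma z3_cases:
  fixes a :: z3
  obtains "a = 0" | "a = 1" | "a = 2"
proof -
  have "a \<in> {0, 1, 2}"
  proof (cases a)
    case (of_int z)
    then have "z = 0 \<or> z = 1 \<or> z = 2" by auto
    then show ?thesis using of_int by auto
  qed
  then show ?thesis using that by blast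
qed

text \<open>Three values for four entries. The arguments with four variables split along the equal
  pair found here.\<close>

lemma z3_pigeonhole:
  fixes a b c d :: z3
  shows "a = b \<or> a = c \<or> a = d \<or> b = c \<or> b = d \<or> c = d"
  by (cases a rule: z3_cases; cases b rule: z3_cases; cases c rule: z3_cases;
      cases d rule: z3_cases; simp)

text \<open>
  These say that the minor identifying \<open>x\<^sub>i\<close> and \<open>x\<^sub>j\<close> does not depend on the merged variable,
  respectively on \<open>x\<^sub>l\<close>.
\<close>

definition collapses :: "((nat \<Rightarrow> 'a) \<Rightarrow> 'b) \<Rightarrow> nat \<Rightarrow> nat \<Rightarrow> bool" where
  "collapses f i j \<longleftrightarrow>
     (\<forall>x y. x i = x j \<longrightarrow> y i = y j \<longrightarrow> (\<forall>k. k \<noteq> i \<longrightarrow> k \<noteq> j \<longrightarrow> x k = y k) \<longrightarrow> f x = f y)"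

definition blind :: "((nat \<Rightarrow> 'a) \<Rightarrow> 'b) \<Rightarrow> nat \<Rightarrow> nat \<Rightarrow> nat \<Rightarrow> bool" where
  "blind f i j l \<longleftrightarrow> (\<forall>x y. x i = x j \<longrightarrow> (\<forall>k. k \<noteq> l \<longrightarrow> x k = y k) \<longrightarrow> f x = f y)"

section \<open>Transfer rules between inessential variables of different minors\<close>

lemma collapsesD:
  "collapses f i j \<Longrightarrow> x i = x j \<Longrightarrow> y i = y j \<Longrightarrow> (\<And>k. k \<noteq> i \<Longrightarrow> k \<noteq> j \<Longrightarrow> x k = y k) \<Longrightarrow> f x = f y"
  unfolding collapses_def by blast

lemma blindD:
  "blind f i j l \<Longrightarrow> x i = x j \<Longrightarrow> (\<And>k. k \<noteq> l \<Longrightarrow> x k = y k) \<Longrightarrow> f x = f y"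
  unfolding blind_def by blast

lemma collapses_commute: "collapses f i j \<longleftrightarrow> collapses f j i"
  unfolding collapses_def by (metis (no_types, lifting))

lemma blind_commute: "blind f i j l \<longleftrightarrow> blind f j i l"
  unfolding blind_def by metis

text \<open>As long as \<open>x i = x j\<close>, the entry at \<open>l\<close> is free: set it to
  \<open>x k\<close>, move the now equal pair \<open>k\<close>, \<open>l\<close> to the new value,
  then restore \<open>l\<close>. The transfer rules below all make such a detour through
  \<open>l\<close>.\<close>

lemma blind_if_collapses:
  assumes "blind f i j l" "collapses f k l" "distinct [i, j, k, l]"
  shows "blind f i j k"
  unfolding blind_def
proof (intro allI impI)
  fix x y :: "nat \<Rightarrow> 'a"
  assume x: "x i = x j" and xy: "\<forall>m. m \<noteq> k \<longrightarrow> x m = y m"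
  have "f x = f (x(l := x k))" by (rule blindD[OF assms(1)]) (use x assms(3) in auto)
  also have "\<dots> = f (y(l := y k))" by (rule collapsesD[OF assms(2)]) (use xy assms(3) in auto)
  also have "\<dots> = f y" by (rule blindD[OF assms(1)]) (use x xy assms(3) in auto)
  finally show "f x = f y" .
qed

lemma blind_if_blind:
  assumes "blind f i j l" "blind f k l m" "distinct [i, j, k, l, m]"
  shows "blind f i j m"
  unfolding blind_def
proof (intro allI impI)
  fix x y :: "nat \<Rightarrow> 'a"
  assume x: "x i = x j" and xy: "\<forall>p. p \<noteq> m \<longrightarrow> x p = y p"
  have "f x = f (x(l := x k))" by (rule blindD[OF assms(1)]) (use x assms(3) in auto)
  also have "\<dots> = f (y(l := y k))" by (rule blindD[OF assms(2)]) (use xy assms(3) in auto)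
  also have "\<dots> = f y" by (rule blindD[OF assms(1)]) (use x xy assms(3) in auto)
  finally show "f x = f y" .
qed

lemma blind_if_blind_shared:
  assumes "blind f i j l" "blind f i l m" "distinct [i, j, l, m]"
  shows "blind f i j m"
  unfolding blind_def
proof (intro allI impI)
  fix x y :: "nat \<Rightarrow> 'a"
  assume x: "x i = x j" and xy: "\<forall>p. p \<noteq> m \<longrightarrow> x p = y p"
  have "f x = f (x(l := x i))" by (rule blindD[OF assms(1)]) (use x assms(3) in auto)
  also have "\<dots> = f (y(l := y i))" by (rule blindD[OF assms(2)]) (use xy assms(3) in auto)
  also have "\<dots> = f y" by (rule blindD[OF assms(1)]) (use x xy assms(3) in auto)
  finally show "f x = f y" .
qed

text \<open>During the detour \<open>x k = x l\<close> holds, so \<open>i\<close> and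
  \<open>j\<close> may be changed one after the other although they can disagree in between.\<close>

lemma collapses_if_blind_both:
  assumes "blind f i j l" "blind f k l i" "blind f k l j" "distinct [i, j, k, l]"
  shows "collapses f i j"
  unfolding collapses_def
proof (intro allI impI)
  fix x y :: "nat \<Rightarrow> 'a"
  assume x: "x i = x j" and y: "y i = y j" and xy: "\<forall>p. p \<noteq> i \<longrightarrow> p \<noteq> j \<longrightarrow> x p = y p"
  have "f x = f (x(l := x k))" by (rule blindD[OF assms(1)]) (use x assms(4) in auto)
  also have "\<dots> = f (x(l := x k, i := y i))" by (rule blindD[OF assms(2)]) (use assms(4) in auto)
  also have "\<dots> = f (y(l := y k))" by (rule blindD[OF assms(3)]) (use xy assms(4) in auto)
  also have "\<dots> = f y" by (rule blindD[OF assms(1)]) (use y assms(4) in auto)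
  finally show "f x = f y" .
qed

text \<open>The detour replaces \<open>x k\<close> by \<open>x j\<close>: with
  \<open>x l = x k\<close>, entry \<open>i\<close> may be set to \<open>x k\<close>, and the equal
  pair \<open>i\<close>, \<open>k\<close> is moved back to the old value of
  \<open>x i\<close>.\<close>

lemma blind_if_collapses_shared:
  assumes "blind f i j l" "blind f k l i" "collapses f i k" "distinct [i, j, k, l]"
  shows "blind f i j k"
proof -
  have *: "f x = f (x(k := x j))" if x: "x i = x j" for x
  proof -
    have "f x = f (x(l := x k))" by (rule blindD[OF assms(1)]) (use x assms(4) in auto)
    also have "\<dots> = f (x(l := x k, i := x k))" by (rule blindD[OF assms(2)]) (use assms(4) in auto)
    also have "\<dots> = f (x(l := x k, k := x j))" by (rule collapsesD[OF assms(3)]) (use x assms(4) in auto)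
    also have "\<dots> = f (x(k := x j))" by (rule blindD[OF assms(1)]) (use x assms(4) in auto)
    finally show ?thesis .
  qed
  show ?thesis
    unfolding blind_def
  proof (intro allI impI)
    fix x y :: "nat \<Rightarrow> 'a"
    assume x: "x i = x j" and xy: "\<forall>m. m \<noteq> k \<longrightarrow> x m = y m"
    have "x(k := x j) = y(k := y j)" using xy assms(4) by (auto simp: fun_eq_iff)
    moreover have "y i = y j" using x xy assms(4) by auto
    ultimately show "f x = f y" using *[of x] *[of y] x by simp
  qed
qed

text \<open>
  Only the variables in \<open>S\<close> count here; the others are parameters. This lets the induction
  on \<open>S\<close> drop a variable without changing \<open>f\<close>.
\<close>

locale gap_at_least_two =
  fixes f :: "(nat \<Rightarrow> z3) \<Rightarrow> 'b" and S :: "nat set"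
  assumes card_ge: "card S \<ge> 4"
    and essential: "l \<in> S \<Longrightarrow> \<exists>x a. f (x(l := a)) \<noteq> f x"
    and collapses_or_blind:
      "i \<in> S \<Longrightarrow> j \<in> S \<Longrightarrow> i \<noteq> j \<Longrightarrow> collapses f i j \<or> (\<exists>l \<in> S - {i, j}. blind f i j l)"
begin

section \<open>Minors with exactly one further inessential variable\<close>

lemma finite_S: "finite S"
  using card_ge by (metis card.infinite not_numeral_le_zero)

text \<open>The obstruction to turning \<open>l\<close> into a parameter: without \<open>l\<close>,
  the pair \<open>i\<close>, \<open>j\<close> would violate
  \<open>collapses_or_blind\<close>.\<close>

definition exact :: "nat \<Rightarrow> nat \<Rightarrow> nat \<Rightarrow> bool" where
  "exact i j l \<longleftrightarrow> i \<in> S \<and> j \<in> S \<and> l \<in> S \<and> distinct [i, j, l] \<and> \<not> collapses f i j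
     \<and> blind f i j l \<and> (\<forall>m \<in> S - {i, j, l}. \<not> blind f i j m)"

lemma exact_commute: "exact i j l \<Longrightarrow> exact j i l"
  unfolding exact_def using collapses_commute[of f i j] blind_commute[of f i j] by auto

lemma exactD:
  assumes "exact i j l"
  shows "i \<in> S" "j \<in> S" "l \<in> S" "distinct [i, j, l]" "\<not> collapses f i j" "blind f i j l"
  using assms unfolding exact_def by auto

lemma exact_unique: "exact i j l \<Longrightarrow> blind f i j m \<Longrightarrow> m \<in> S \<Longrightarrow> m \<noteq> i \<Longrightarrow> m \<noteq> j \<Longrightarrow> m = l"
  unfolding exact_def by auto

lemma exact_blind_other:
  assumes "exact i j l" "blind f i l m" "m \<in> S" "m \<noteq> i" "m \<noteq> l"
  shows "m = j"
proof (rule ccontr)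
  assume "m \<noteq> j"
  then have "blind f i j m"
    using blind_if_blind_shared[of f i j l m] assms exactD[OF assms(1)] by auto
  then show False using exact_unique[OF assms(1)] assms \<open>m \<noteq> j\<close> by blast
qed

text \<open>The alternatives contradict \<open>exact i j l\<close>: if \<open>k\<close>,
  \<open>l\<close> collapsed, then \<open>k\<close> would be inessential for \<open>i\<close>,
  \<open>j\<close>; an inessential variable of \<open>k\<close>, \<open>l\<close> outside
  \<open>{i, j}\<close> would pass to \<open>i\<close>, \<open>j\<close>; if both \<open>i\<close>
  and \<open>j\<close> were inessential for \<open>k\<close>, \<open>l\<close>, the pair
  \<open>i\<close>, \<open>j\<close> would collapse.\<close>

lemma exact_third:
  assumes ex: "exact i j l" and k: "k \<in> S" "k \<notin> {i, j, l}"
  shows "exact k l i \<or> exact k l j"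
proof -
  note e = exactD[OF ex]
  have d: "distinct [i, j, k, l]" using e(4) k by auto
  have nc: "\<not> collapses f k l"
    using blind_if_collapses[OF e(6) _ d] exact_unique[OF ex] k by blast
  have sub: "m \<in> {i, j}" if "blind f k l m" "m \<in> S" "m \<noteq> k" "m \<noteq> l" for m
    using blind_if_blind[OF e(6) that(1)] exact_unique[OF ex] that d by fastforce
  have nb: "\<not> (blind f k l i \<and> blind f k l j)"
    using collapses_if_blind_both[OF e(6) _ _ d] e(5) by blast
  obtain m where "m \<in> S - {k, l}" "blind f k l m"
    using collapses_or_blind[of k l] nc e k by auto
  then show ?thesis unfolding exact_def using sub nb nc e k d by auto
qed

lemma exact_chain:
  assumes ex: "exact i j l" and ex': "exact k l i" and kj: "k \<noteq> j"
  shows "collapses f i l" "exact i k l" "exact j l i"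
proof -
  note e = exactD[OF ex] and e' = exactD[OF ex']
  have d: "distinct [i, j, k, l]" using e(4) e'(4) kj by auto
  \<comment> \<open>An inessential variable for \<open>i\<close>, \<open>l\<close> would have to be
    both \<open>j\<close> and \<open>k\<close>.\<close>
  have "\<not> blind f i l m" if "m \<in> S - {i, l}" for m
    using exact_blind_other[OF ex, of m] exact_blind_other[OF exact_commute[OF ex'], of m]
      blind_commute[of f i l] that d by auto
  then show "collapses f i l" using collapses_or_blind[of i l] e by auto
  have nik: "\<not> collapses f i k"
    using blind_if_collapses_shared[OF e(6) e'(6) _ d] exact_unique[OF ex, of k] e'(1) d by auto
  have ik: "m = l" if "blind f i k m" "m \<in> S" "m \<noteq> i" "m \<noteq> k" for m
    using exact_blind_other[OF ex', of m] blind_commute[of f i k] that by auto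
  show ikl: "exact i k l"
    using collapses_or_blind[of i k] nik ik e e' d unfolding exact_def by auto
  have "exact j l i \<or> exact j l k"
    using exact_third[OF ikl, of j] e d by auto
  moreover have "\<not> exact j l k"
    using exact_blind_other[OF exact_commute[OF ex], of k] exactD[of j l k] d by auto
  ultimately show "exact j l i" by blast
qed

text \<open>For a new \<open>s\<close>, \<open>exact_third\<close> applied to
  \<open>exact k l i\<close> and to \<open>exact j l i\<close> leaves \<open>exact s i l\<close> as
  the only common alternative, because \<open>j\<close> and \<open>k\<close> differ.\<close>

lemma exact_all:
  assumes ex: "exact i j l" and ex': "exact k l i" and kj: "k \<noteq> j" and s: "s \<in> S - {i, l}"
  shows "exact s i l"
proof -
  note c = exact_chain[OF ex ex' kj]
  note e = exactD[OF ex] and e' = exactD[OF ex']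
  consider "s = j" | "s = k" | "s \<notin> {i, j, k, l}" using s by blast
  then show ?thesis
  proof cases
    case 3
    have "exact s i k \<or> exact s i l" using exact_third[OF ex', of s] s 3 by auto
    moreover have "exact s i j \<or> exact s i l" using exact_third[OF c(3), of s] s 3 by auto
    ultimately show ?thesis
      using exact_unique[of s i k j] exactD[of s i j] kj by auto
  qed (use ex c(2) exact_commute in auto)
qed

lemma ex_outside:
  assumes "finite A" "card A < card S"
  obtains k where "k \<in> S" "k \<notin> A"
  using assms card_mono[of A S] by (meson leD subsetI)

text \<open>A fourth variable starts a chain with \<open>v = l\<close> and \<open>u\<close> one of
  \<open>i\<close>, \<open>j\<close>. The chain is symmetric in \<open>u\<close> and
  \<open>v\<close>, hence both conclusions about \<open>s\<close>.\<close>

lemma exact_structure: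
  assumes "exact i j l"
  obtains u v where "u \<in> S" "v \<in> S" "u \<noteq> v" "collapses f u v"
    and "\<And>s. s \<in> S - {u, v} \<Longrightarrow> exact s u v \<and> exact s v u"
proof -
  note wit = that
  have main: thesis if ex: "exact u w v" and ex': "exact k v u" and k: "k \<noteq> w" for u w v k
  proof (rule wit[of u v])
    show "collapses f u v" by (rule exact_chain[OF ex ex' k])
    show "exact s u v \<and> exact s v u" if "s \<in> S - {u, v}" for s
    proof
      show "exact s u v" by (rule exact_all[OF ex ex' k that])
      show "exact s v u"
        using exact_all[OF exact_commute[OF ex'] exact_commute[OF ex]] k that by blast
    qed
  qed (use exactD[OF ex] in auto)
  have "card {i, j, l} < card S" using card_ge by (simp add: card_insert_if)
  then obtain k where k: "k \<in> S" "k \<notin> {i, j, l}" using ex_outside[of "{i, j, l}"] by blast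
  then consider "exact k l i" | "exact k l j" using exact_third[OF assms] by blast
  then show thesis
  proof cases
    case 1 then show ?thesis using main[OF assms, of k] k by auto
  next
    case 2 then show ?thesis using main[OF exact_commute[OF assms], of k] k by auto
  qed
qed

text \<open>
  If \<open>x\<^sub>u\<close> or \<open>x\<^sub>v\<close> occurs among the other values, or \<open>x\<^sub>u = x\<^sub>v\<close>, then \<open>f\<close> ignores
  both \<open>x\<^sub>u\<close> and \<open>x\<^sub>v\<close>. In the only other case all the other variables agree, as there are
  just three values.
\<close>

lemma no_exact: "\<not> exact i j l"
proof
  assume "exact i j l"
  obtain u v where uv: "u \<in> S" "v \<in> S" "u \<noteq> v" "collapses f u v"
    and ex: "\<And>s. s \<in> S - {u, v} \<Longrightarrow> exact s u v \<and> exact s v u"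
    using exact_structure[OF \<open>exact i j l\<close>] by metis
  have "card {u, v} < card S" using card_ge by (simp add: card_insert_if)
  then obtain p where p: "p \<in> S" "p \<notin> {u, v}" using ex_outside[of "{u, v}"] by blast
  have "card {u, v, p} < card S" using card_ge by (simp add: card_insert_if)
  then obtain q where q: "q \<in> S" "q \<notin> {u, v, p}" using ex_outside[of "{u, v, p}"] by blast
  \<comment> \<open>Both \<open>u\<close> and \<open>v\<close> are overwritten; as this pair
    collapses, the common value \<open>a\<close> is irrelevant.\<close>
  define h where "h x a = f (x(u := a, v := a))" for x a
  have h: "h x a = h x b" for x a b
    unfolding h_def by (rule collapsesD[OF uv(4)]) (use uv(3) in auto)
  have bu: "blind f s u v" and bv: "blind f s v u" if "s \<in> S - {u, v}" for s
    using ex[OF that] exactD by blast+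
  have on_u: "f x = h x a" if s: "s \<in> S - {u, v}" and xs: "x s = x u" for x s a
  proof -
    have "f x = h x (x u)" unfolding h_def
      by (rule blindD[OF bu[OF s]]) (use uv(3) xs s in auto)
    then show ?thesis using h by metis
  qed
  have on_v: "f x = h x a" if s: "s \<in> S - {u, v}" and xs: "x s = x v" for x s a
  proof -
    have "f x = h x (x v)" unfolding h_def
      by (rule blindD[OF bv[OF s]]) (use uv(3) xs s in auto)
    then show ?thesis using h by metis
  qed
  have on_uv: "f x = h x a" if "x u = x v" for x a
  proof -
    have "f x = h x (x u)" unfolding h_def using that by (simp add: fun_upd_idem)
    then show ?thesis using h by metis
  qed
  have all: "f x = h x a" for x a
  proof -
    consider "x u = x v" | "x p = x u" | "x p = x v" | "x q = x u" | "x q = x v"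
      | "x p = x q" "x u \<noteq> x p" "x v \<noteq> x p" "x u \<noteq> x v"
      using z3_pigeonhole[of "x u" "x v" "x p" "x q"] by metis
    then show ?thesis
    proof cases
      case 6
      have pq: "p \<in> S - {u, v}" "q \<in> S - {u, v}" using p q uv by auto
      \<comment> \<open>If \<open>p\<close>, \<open>q\<close> collapse, both move to
        \<open>x u\<close>, a case already settled. Otherwise \<open>u\<close> or \<open>v\<close>
        is inessential for \<open>p\<close>, \<open>q\<close> and can be set to
        \<open>x p\<close>.\<close>
      show ?thesis
      proof (cases "collapses f p q")
        case True
        define y where "y = x(p := x u, q := x u)"
        have "f x = f y" unfolding y_def
          by (rule collapsesD[OF True]) (use 6 q in auto)
        also have "\<dots> = h y a" by (rule on_u[OF pq(1)]) (use p q y_def in auto)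
        also have "\<dots> = h x a" unfolding h_def y_def
          by (rule collapsesD[OF True]) (use 6 p q in auto)
        finally show ?thesis .
      next
        case False
        then obtain m where m: "m \<in> S" "m \<noteq> p" "m \<noteq> q" "blind f p q m"
          using collapses_or_blind[of p q] p q by auto
        have b: "blind f p q u \<or> blind f p q v"
        proof (cases "m \<in> {u, v}")
          case False
          then show ?thesis
            using blind_if_blind[OF m(4) _, of v u] bv[of m] blind_commute[of f v m] m p q uv by auto
        qed (use m in auto)
        then show ?thesis
        proof
          assume "blind f p q u"
          then have "f x = f (x(u := x p))" by (rule blindD) (use 6 in auto)
          also have "\<dots> = h (x(u := x p)) a" by (rule on_u[OF pq(1)]) (use p in auto)
          also have "\<dots> = h x a" unfolding h_def by simp
          finally show ?thesis .
        next
          assume "blind f p q v"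
          then have "f x = f (x(v := x p))" by (rule blindD) (use 6 in auto)
          also have "\<dots> = h (x(v := x p)) a" by (rule on_v[OF pq(1)]) (use p in auto)
          also have "\<dots> = h x a" unfolding h_def by (metis fun_upd_twist fun_upd_upd)
          finally show ?thesis .
        qed
      qed
    qed (use on_uv on_u[of p] on_u[of q] on_v[of p] on_v[of q] p q in auto)
  qed
  obtain x a where "f (x(u := a)) \<noteq> f x" using essential[OF uv(1)] by blast
  moreover have "f (x(u := a)) = f x"
    using all[of x 0] all[of "x(u := a)" 0] unfolding h_def by simp
  ultimately show False by simp
qed

text \<open>With \<open>exact\<close> excluded, an inessential variable besides \<open>l\<close>
  remains, so \<open>collapses_or_blind\<close> survives the removal of \<open>l\<close> from
  \<open>S\<close>.\<close>

lemma two_blind: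
  assumes "i \<in> S" "j \<in> S" "i \<noteq> j" "\<not> collapses f i j" "l \<in> S - {i, j}"
  shows "\<exists>m \<in> S - {i, j, l}. blind f i j m"
proof (rule ccontr)
  assume none: "\<not> ?thesis"
  then have "blind f i j l" using collapses_or_blind[of i j] assms by auto
  then have "exact i j l" unfolding exact_def using none assms by auto
  then show False using no_exact by blast
qed

text \<open>If the pair does not collapse, both other variables are inessential in its minor, where
  \<open>f\<close> thus takes its diagonal value \<open>D\<close>. Comparing all equal pairs shows
  that one entry \<open>x t\<close> with \<open>t\<close> in \<open>{i, j}\<close> determines
  \<open>f\<close> up to parameters, so the other element of \<open>{i, j}\<close> is
  inessential.\<close>

lemma four_variables:
  assumes S: "S = {i, j, k, l}" and d: "distinct [i, j, k, l]"
  shows "collapses f i j"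
proof (rule ccontr)
  assume nc: "\<not> collapses f i j"
  have blind2: "blind f p q r \<and> blind f p q s"
    if "\<not> collapses f p q" "S = {p, q, r, s}" "distinct [p, q, r, s]" for p q r s
    using two_blind[of p q r] two_blind[of p q s] that by auto
  define D where "D x a = f (x(i := a, j := a, k := a, l := a))" for x a
  have D: "f y = D x a" if "\<And>p. p \<notin> S \<Longrightarrow> y p = x p" "\<And>p. p \<in> S \<Longrightarrow> y p = a" for x y a
  proof -
    have "y = x(i := a, j := a, k := a, l := a)" using that S by (auto simp: fun_eq_iff)
    then show ?thesis unfolding D_def by simp
  qed
  have D_cong: "D x a = D y a" if "\<And>p. p \<notin> S \<Longrightarrow> x p = y p" for x y a
    unfolding D_def by (rule arg_cong[of _ _ f]) (use that S in \<open>auto simp: fun_eq_iff\<close>)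
  have diag: "f x = D x (x p)"
    if "\<not> collapses f p q" "S = {p, q, r, s}" "distinct [p, q, r, s]" "x p = x q" for x p q r s
  proof -
    have b: "blind f p q r" "blind f p q s" using blind2[OF that(1-3)] by auto
    have "f x = f (x(r := x p))" by (rule blindD[OF b(1)]) (use that in auto)
    also have "\<dots> = f (x(r := x p, s := x p))" by (rule blindD[OF b(2)]) (use that in auto)
    also have "\<dots> = D x (x p)" by (rule D) (use that in auto)
    finally show ?thesis .
  qed
  have D_nonconst: "\<not> (\<forall>x a b. D x a = D x b)"
  proof
    assume const: "\<forall>x a b. D x a = D x b"
    have "collapses f i j" unfolding collapses_def
    proof (intro allI impI)
      fix x y :: "nat \<Rightarrow> z3"
      assume x: "x i = x j" and y: "y i = y j" and xy: "\<forall>k. k \<noteq> i \<longrightarrow> k \<noteq> j \<longrightarrow> x k = y k"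
      have "D x 0 = D y 0" by (rule D_cong) (use xy S in auto)
      then show "f x = f y"
        using diag[OF nc S d x] diag[OF nc S d y] const by metis
    qed
    then show False using nc by blast
  qed
  have kl: "collapses f k l"
  proof (rule ccontr)
    assume ncl: "\<not> collapses f k l"
    have "D x a = D x b" for x a b
    proof -
      let ?y = "x(i := a, j := a, k := b, l := b)"
      have "f ?y = D ?y (?y i)" by (rule diag[OF nc S d]) (use d in auto)
      moreover have "f ?y = D ?y (?y k)"
        by (rule diag[OF ncl, of i j]) (use S d in auto)
      moreover have "D ?y c = D x c" for c
        by (rule D_cong) (use S in auto)
      ultimately show ?thesis using d by simp
    qed
    then show False using D_nonconst by blast
  qed
  \<comment> \<open>For each mixed pair \<open>p\<close>, \<open>q\<close>, one of \<open>i\<close>,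
    \<open>j\<close> selects the diagonal value; the aim is a common selector \<open>t\<close> for
    all four mixed pairs.\<close>
  define C where "C t p q \<longleftrightarrow> (\<forall>x. x p = x q \<longrightarrow> f x = D x (x t))" for t p q
  have C_cases: "C i p q \<or> C j p q" if p: "p \<in> {i, j}" and q: "q \<in> {k, l}" for p q
  proof -
    obtain r where r: "{p, r} = {i, j}" "r \<noteq> p" using p d by auto
    obtain s where s: "{q, s} = {k, l}" "s \<noteq> q" using q d by auto
    have S': "S = {p, q, r, s}" using S r s by auto
    have d': "distinct [p, q, r, s]" using r s d by auto
    have "C p p q \<or> C r p q"
    proof (cases "collapses f p q")
      case True
      have "f x = D x (x r)" if x: "x p = x q" for x
      proof -
        let ?y = "x(p := x r, q := x r)"
        have "f x = f ?y" by (rule collapsesD[OF True]) (use x d' in auto)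
        also have "\<dots> = D ?y (?y i)" by (rule diag[OF nc S d]) (use r d' in auto)
        also have "?y i = x r" using r d' by auto
        also have "D ?y (x r) = D x (x r)" by (rule D_cong) (use S' in auto)
        finally show ?thesis .
      qed
      then show ?thesis unfolding C_def by blast
    next
      case False
      then show ?thesis unfolding C_def using diag[OF False S' d'] by blast
    qed
    then show ?thesis using r by auto
  qed
  \<comment> \<open>Both equalities can hold together with \<open>x i = a\<close> and
    \<open>x j = b\<close>, which gives \<open>D x a = D x b\<close>. Only pairs sharing
    \<open>q\<close> with different \<open>p\<close> would force \<open>a = b\<close>.\<close>
  have conflict: "\<not> C j p' q'"
    if C: "C i p q" and pq: "p \<in> {i, j}" "p' \<in> {i, j}" "q \<in> {k, l}" "q' \<in> {k, l}" "p = p' \<or> q \<noteq> q'"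
    for p q p' q'
  proof
    assume C': "C j p' q'"
    have "D x a = D x b" for x a b
    proof -
      define v where "v t = (if t = i then a else b)" for t
      define y where "y = x(i := a, j := b, q := v p, q' := v p')"
      have out: "p \<notin> {q, q'}" "p' \<notin> {q, q'}" "i \<notin> {q, q'}" "j \<notin> {q, q'}" "i \<noteq> j"
        using pq d by auto
      have y_ij: "y i = a" "y j = b" using out unfolding y_def by simp_all
      then have "y p = v p" "y p' = v p'" using pq(1,2) out(5) unfolding v_def by auto
      moreover have "y q' = v p'" unfolding y_def by simp
      moreover have "y q = v p" using pq(5) unfolding y_def by auto
      ultimately have "y p = y q" "y p' = y q'" by simp_all
      then have "f y = D y (y i)" "f y = D y (y j)"
        using C C' unfolding C_def by blast+
      moreover have "D y c = D x c" for c
        by (rule D_cong) (use S pq in \<open>auto simp: y_def\<close>)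
      ultimately show ?thesis using y_ij by simp
    qed
    then show False using D_nonconst by blast
  qed
  \<comment> \<open>The selector of \<open>i\<close>, \<open>k\<close> spreads to the two pairs with
    \<open>l\<close>, and from there to \<open>j\<close>, \<open>k\<close>.\<close>
  have "\<exists>t \<in> {i, j}. \<forall>p \<in> {i, j}. \<forall>q \<in> {k, l}. C t p q"
  proof (cases "C i i k")
    case True
    then have "C i i l" "C i j l" using conflict[of i k i l] conflict[of i k j l] C_cases d by auto
    moreover then have "C i j k" using conflict[of i l j k] C_cases d by auto
    ultimately show ?thesis using True by auto
  next
    case False
    then have jik: "C j i k" using C_cases by auto
    then have "C j i l" "C j j l" using conflict[of i l i k] conflict[of j l i k] C_cases d by auto
    moreover then have "C j j k" using conflict[of j k i l] C_cases d by auto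
    ultimately show ?thesis using jik by auto
  qed
  then obtain t where t: "t \<in> {i, j}" and C: "\<And>p q. p \<in> {i, j} \<Longrightarrow> q \<in> {k, l} \<Longrightarrow> C t p q"
    by blast
  have all: "f x = D x (x t)" for x
  proof -
    consider (ij) "x i = x j" | (kl) "x k = x l"
      | (pq) p q where "p \<in> {i, j}" "q \<in> {k, l}" "x p = x q"
      using z3_pigeonhole[of "x i" "x j" "x k" "x l"] by blast
    then show ?thesis
    proof cases
      case ij
      then show ?thesis using diag[OF nc S d ij] t by auto
    next
      case kl
      let ?y = "x(k := x i, l := x i)"
      have "f x = f ?y" by (rule collapsesD[OF \<open>collapses f k l\<close>]) (use kl d in auto)
      also have "\<dots> = D ?y (?y t)"
        using C[of i k] unfolding C_def by (rule meta_mp[rotated]) (use d in auto)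
      also have "\<dots> = D x (?y t)" by (rule D_cong) (use S in auto)
      also have "?y t = x t" using t d by auto
      finally show ?thesis .
    next
      case pq
      then show ?thesis using C unfolding C_def by blast
    qed
  qed
  obtain u where u: "u \<in> {i, j}" "u \<noteq> t" using t d by auto
  then obtain x a where "f (x(u := a)) \<noteq> f x" using essential[of u] S by auto
  moreover have "D (x(u := a)) (x t) = D x (x t)" by (rule D_cong) (use S u in auto)
  ultimately show False using all[of x] all[of "x(u := a)"] u by simp
qed

end

text \<open>Induction on \<open>card S\<close> down to \<open>four_variables\<close>: a variable
  \<open>m\<close> outside the pair becomes a parameter, which \<open>two_blind\<close>
  permits.\<close>

theorem all_collapse:
  assumes "gap_at_least_two f S" "i \<in> S" "j \<in> S" "i \<noteq> j"
  shows "collapses f i j"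
  using assms
proof (induction "card S" arbitrary: S rule: less_induct)
  case less
  interpret gap_at_least_two f S by fact
  note ij = less.prems(2-4)
  have cS: "card (S - {i, j}) = card S - 2"
    using ij finite_S by (simp add: card_Diff_subset)
  show ?case
  proof (cases "card S = 4")
    case True
    then have "card (S - {i, j}) = 2" using cS by simp
    then obtain k l where "S - {i, j} = {k, l}" "k \<noteq> l" by (meson card_2_iff)
    then have "S = {i, j, k, l}" "distinct [i, j, k, l]" using ij by auto
    then show ?thesis by (rule four_variables)
  next
    case False
    then have ge: "card S \<ge> 5" using card_ge by simp
    then have "card (S - {i, j}) \<noteq> 0" using cS by linarith
    then have "S - {i, j} \<noteq> {}" by force
    then obtain m where m: "m \<in> S" "m \<noteq> i" "m \<noteq> j" by auto
    have "gap_at_least_two f (S - {m})"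
    proof
      show "card (S - {m}) \<ge> 4" using ge m finite_S by simp
      fix p q assume pq: "p \<in> S - {m}" "q \<in> S - {m}" "p \<noteq> q"
      show "collapses f p q \<or> (\<exists>l \<in> S - {m} - {p, q}. blind f p q l)"
        using two_blind[of p q m] pq m by auto
    qed (use essential in auto)
    moreover have "card (S - {m}) < card S" using card_Diff1_less[OF finite_S m(1)] .
    ultimately show ?thesis using less.hyps[of "S - {m}"] ij m by auto
  qed
qed

section \<open>Parities of occurrences\<close>

text \<open>Normal forms: for \<open>n \<ge> 2\<close>, the pairs \<open>(0, 0)\<close>,
  \<open>(1, 0)\<close>, \<open>(2, 0)\<close>, \<open>(1, 2)\<close> realise each possible parity
  vector once.\<close>

definition rep :: "z3 \<Rightarrow> z3 \<Rightarrow> nat \<Rightarrow> z3" where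
  "rep a b = (\<lambda>i. if i = 1 then a else if i = 2 then b else 0)"

text \<open>If none of the entries at \<open>p\<close>, \<open>q\<close>, \<open>r\<close> equals
  \<open>x m\<close>, two of them agree; they move to \<open>x m\<close>, and then one of them is
  cleared together with \<open>m\<close>. The clause on \<open>r\<close> preserves a zero obtained
  earlier.\<close>

lemma collapse_clear:
  fixes F :: "(nat \<Rightarrow> z3) \<Rightarrow> 'b"
  assumes coll: "\<And>i j. i \<in> S \<Longrightarrow> j \<in> S \<Longrightarrow> i \<noteq> j \<Longrightarrow> collapses F i j"
    and S: "{p, q, r, m} \<subseteq> S" and d: "distinct [p, q, r, m]"
  shows "\<exists>y. F y = F x \<and> y m = 0 \<and> (x r = 0 \<longrightarrow> y r = 0) \<and> (\<forall>k. k \<notin> {p, q, r, m} \<longrightarrow> y k = x k)"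
proof -
  have direct: ?thesis if s: "s \<in> {p, q, r}" and eq: "x s = x m" for s
  proof (intro exI conjI)
    show "F (x(s := 0, m := 0)) = F x"
      by (rule collapsesD[OF coll[of s m]]) (use s S d eq in auto)
  qed (use s d in auto)
  have via: ?thesis
    if s: "s \<in> {p, q, r}" "t \<in> {p, q, r}" "s \<noteq> t" "s \<noteq> r" and eq: "x s = x t" for s t
  proof (intro exI conjI)
    have "F (x(s := x m, t := 0, m := 0)) = F (x(s := x m, t := x m))"
      by (rule collapsesD[OF coll[of t m]]) (use s S d eq in auto)
    also have "\<dots> = F x"
      by (rule collapsesD[OF coll[of s t]]) (use s S d eq in auto)
    finally show "F (x(s := x m, t := 0, m := 0)) = F x" .
  qed (use s d in auto)
  show ?thesis
    using z3_pigeonhole[of "x p" "x q" "x r" "x m"]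
      direct[of p] direct[of q] direct[of r] via[of p q] via[of p r] via[of q r] d by auto
qed

lemma collapse_to_rep:
  fixes F :: "(nat \<Rightarrow> z3) \<Rightarrow> 'b"
  assumes n: "n \<ge> 4"
    and coll: "\<And>i j. i \<in> {1..n} \<Longrightarrow> j \<in> {1..n} \<Longrightarrow> i \<noteq> j \<Longrightarrow> collapses F i j"
    and dep: "\<And>x y. (\<And>i. i \<in> {1..n} \<Longrightarrow> x i = y i) \<Longrightarrow> F x = F y"
  shows "\<exists>a b. (a, b) \<in> {(0, 0), (1, 0), (2, 0), (1, 2)} \<and> F x = F (rep a b)"
proof -
  have clear: "m \<le> n \<Longrightarrow> \<exists>y. F y = F x \<and> (\<forall>k \<in> {4..m}. y k = 0)" for m
  proof (induction m)
    case (Suc m)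
    then obtain y where y: "F y = F x" "\<forall>k \<in> {4..m}. y k = 0" by auto
    show ?case
    proof (cases "Suc m \<ge> 4")
      case True
      obtain z where z: "F z = F y" "z (Suc m) = 0" "\<forall>k. k \<notin> {1, 2, 3, Suc m} \<longrightarrow> z k = y k"
        using collapse_clear[of "{1..n}" F 1 2 3 "Suc m" y, OF coll] Suc.prems True by auto
      have "z k = 0" if "k \<in> {4..Suc m}" for k
        using that z y(2) by (cases "k = Suc m") auto
      then show ?thesis using y(1) z(1) by metis
    qed (use y in auto)
  qed auto
  obtain y where y: "F y = F x" "\<forall>k \<in> {4..n}. y k = 0" using clear[of n] by blast
  \<comment> \<open>Position 3 is cleared with position 4 in the role of \<open>r\<close>, so that
    the zero there survives.\<close>
  obtain z where z: "F z = F y" "z 3 = 0" "z 4 = 0" "\<forall>k. k \<notin> {1, 2, 4, 3} \<longrightarrow> z k = y k"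
    using collapse_clear[of "{1..n}" F 1 2 4 3 y, OF coll] n y(2) by auto
  have zero: "z k = 0" if "k \<in> {3..n}" for k
    using that z y(2) by (cases "k = 3 \<or> k = 4") auto
  define H where "H a b c d = F ((\<lambda>_. 0)(1 := a, 2 := b, 3 := c, 4 := d))" for a b c d
  have H: "H t t c d = H u u c d" "H t b t d = H u b u d" 
    "H a t t d = H a u u d" "H a b t t = H a b u u" for a b c d t u
    unfolding H_def
    by (rule collapsesD[OF coll[of 1 2]] collapsesD[OF coll[of 1 3]] collapsesD[OF coll[of 2 3]]
        collapsesD[OF coll[of 3 4]]; use n in auto)+
  have rep: "H a b 0 0 = F (rep a b)" for a b
    unfolding H_def rep_def by (rule dep) auto
  have Fz: "F z = H (z 1) (z 2) 0 0"
    unfolding H_def by (rule dep) (use zero in auto)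
  \<comment> \<open>Moving equal pairs among the first four positions reduces the nine pairs
    \<open>(z 1, z 2)\<close> to four.\<close>
  have R0: "H 1 1 0 0 = H 0 0 0 0" "H 2 2 0 0 = H 0 0 0 0" by (rule H)+
  have R1: "H 0 t 0 0 = H t 0 0 0" for t
    using H(2)[of 0 t 0 t] H(3)[of t t 0 0] by simp
  have R2: "H 2 1 0 0 = H 1 2 0 0"
    using H(4)[of 2 1 0 1] H(3)[of 2 1 1 2] H(2)[of 2 2 1 1] H(4)[of 1 2 1 0] by simp
  have "F z \<in> {H 0 0 0 0, H 1 0 0 0, H 2 0 0 0, H 1 2 0 0}"
    by (cases "z 1" rule: z3_cases; cases "z 2" rule: z3_cases;
        simp add: Fz R0 R1[of 1] R1[of 2] R2)
  then have "\<exists>a b. (a, b) \<in> {(0, 0), (1, 0), (2, 0), (1, 2)} \<and> F z = H a b 0 0" by blast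
  then show ?thesis using rep z(1) y(1) by simp
qed

section \<open>Parity vectors as a complete invariant\<close>

definition par :: "nat \<Rightarrow> (nat \<Rightarrow> 'a) \<Rightarrow> 'a \<Rightarrow> bool" where
  "par n x a \<longleftrightarrow> odd (card {i \<in> {1..n}. x i = a})"

lemma par_0 [simp]: "\<not> par 0 x a"
  by (simp add: par_def)

lemma par_Suc [simp]: "par (Suc n) x a \<longleftrightarrow> par n x a \<noteq> (x (Suc n) = a)"
proof -
  have "{i \<in> {1..Suc n}. x i = a} =
      (if x (Suc n) = a then insert (Suc n) {i \<in> {1..n}. x i = a} else {i \<in> {1..n}. x i = a})"
    by (auto simp: le_Suc_eq)
  then show ?thesis unfolding par_def by auto
qed

lemma par_cong: "(\<And>i. i \<in> {1..n} \<Longrightarrow> x i = y i) \<Longrightarrow> par n x = par n y"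
proof (rule ext)
  fix a
  assume "\<And>i. i \<in> {1..n} \<Longrightarrow> x i = y i"
  then have "{i \<in> {1..n}. x i = a} = {i \<in> {1..n}. y i = a}" by auto
  then show "par n x a = par n y a" unfolding par_def by simp
qed

text \<open>An equal pair contributes 0 or 2 to each count.\<close>

lemma collapses_par:
  assumes "i \<in> {1..n}" "j \<in> {1..n}" "i \<noteq> j"
  shows "collapses (par n) i j"
proof -
  have *: "par n x a \<longleftrightarrow> odd (card {k \<in> {1..n} - {i, j}. x k = a})" if "x i = x j" for x and a :: 'a
  proof -
    have "{k \<in> {1..n}. x k = a} =
        {k \<in> {1..n} - {i, j}. x k = a} \<union> (if x i = a then {i, j} else {})"
      using assms that by auto
    also have "card \<dots> = card {k \<in> {1..n} - {i, j}. x k = a} + (if x i = a then 2 else 0)"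
      using assms(3) by (subst card_Un_disjoint) auto
    finally show ?thesis unfolding par_def by auto
  qed
  have "par n x a = par n y a"
    if "x i = x j" "y i = y j" "\<forall>k. k \<noteq> i \<longrightarrow> k \<noteq> j \<longrightarrow> x k = y k" for x y and a :: 'a
  proof -
    have "{k \<in> {1..n} - {i, j}. x k = a} = {k \<in> {1..n} - {i, j}. y k = a}"
      using that(3) by auto
    then show ?thesis using *[OF that(1), of a] *[OF that(2), of a] by simp
  qed
  then show ?thesis unfolding collapses_def fun_eq_iff by blast
qed

text \<open>The three counts add up to \<open>n\<close>. Hence at most four parity vectors occur for
  a given \<open>n\<close>.\<close>

lemma odd_iff_par: "odd n \<longleftrightarrow> (par n x 0 \<noteq> par n x 1) \<noteq> par n x (2::z3)"
proof (induction n)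
  case (Suc n)
  then show ?case by (cases "x (Suc n)" rule: z3_cases) auto
qed simp

lemma par_rep:
  assumes "n \<ge> 2"
  shows "par n (rep a b) v \<longleftrightarrow> ((a = v) \<noteq> (b = v)) \<noteq> (odd n \<and> v = 0)"
  using assms
proof (induction n rule: nat_induct_at_least)
  case base
  have "par (Suc (Suc 0)) (rep a b) v \<longleftrightarrow> (a = v) \<noteq> (b = v)" by (simp add: rep_def)
  then show ?case by (simp add: numeral_2_eq_2)
next
  case (Suc n)
  then show ?case by (auto simp: rep_def)
qed

lemma par_determines:
  fixes F :: "(nat \<Rightarrow> z3) \<Rightarrow> 'b"
  assumes n: "n \<ge> 4"
    and coll: "\<And>i j. i \<in> {1..n} \<Longrightarrow> j \<in> {1..n} \<Longrightarrow> i \<noteq> j \<Longrightarrow> collapses F i j"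
    and dep: "\<And>x y. (\<And>i. i \<in> {1..n} \<Longrightarrow> x i = y i) \<Longrightarrow> F x = F y"
    and par: "par n x = par n y"
  shows "F x = F y"
proof -
  let ?R = "{(0, 0), (1, 0), (2, 0), (1, 2)} :: (z3 \<times> z3) set"
  \<comment> \<open>Pairing \<open>F\<close> with \<open>par n\<close> yields one representative
    having both the value and the parities of \<open>z\<close>.\<close>
  have "\<exists>a b. (a, b) \<in> ?R \<and> (F z, par n z) = (F (rep a b), par n (rep a b))" for z
  proof (rule collapse_to_rep[OF n])
    show "collapses (\<lambda>x. (F x, par n x)) i j" if "i \<in> {1..n}" "j \<in> {1..n}" "i \<noteq> j" for i j
      using coll[OF that] collapses_par[OF that] unfolding collapses_def by blast
    show "(F u, par n u) = (F w, par n w)" if "\<And>i. i \<in> {1..n} \<Longrightarrow> u i = w i" for u w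
      using dep[of u w, OF that] par_cong[of n u w, OF that] by simp
  qed
  then obtain a b c d where
    ab: "(a, b) \<in> ?R" "F x = F (rep a b)" "par n x = par n (rep a b)" and
    cd: "(c, d) \<in> ?R" "F y = F (rep c d)" "par n y = par n (rep c d)"
    unfolding prod.inject by metis
  have "(a = v) = (b = v) \<longleftrightarrow> (c = v) = (d = v)" for v
  proof -
    have "par n (rep a b) v = par n (rep c d) v" using ab cd par by simp
    then show ?thesis using n by (auto simp: par_rep)
  qed
  note key = this[of 0] this[of 1] this[of 2]
  have "\<forall>r \<in> ?R. \<forall>s \<in> ?R.
      ((fst r = 0) = (snd r = 0)) = ((fst s = 0) = (snd s = 0)) \<longrightarrow>
      ((fst r = 1) = (snd r = 1)) = ((fst s = 1) = (snd s = 1)) \<longrightarrow>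
      ((fst r = 2) = (snd r = 2)) = ((fst s = 2) = (snd s = 2)) \<longrightarrow> r = s" by simp
  from this[rule_format, OF ab(1) cd(1), unfolded fst_conv snd_conv, OF key]
  show ?thesis using ab cd by simp
qed

section \<open>Evaluation of the symmetric differences\<close>

lemma mem_symdiff_iff: "v \<in> A \<oplus> B \<longleftrightarrow> (v \<in> A) \<noteq> (v \<in> B)"
  by (auto simp: symdiff_def)

text \<open>A value survives if an odd number of indices produce it; \<open>\<noteq>\<close> on
  truth values acts as exclusive or, which also covers coinciding values of
  \<open>g\<close>.\<close>

lemma mem_Symdiff_values:
  "v \<in> Symdiff (\<lambda>i. {g (x i)}) {1..n} \<longleftrightarrow>
     ((par n x 0 \<and> v = g 0) \<noteq> (par n x 1 \<and> v = g 1)) \<noteq> (par n x (2::z3) \<and> v = g 2)"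
proof (induction n)
  case (Suc n)
  have "{1..Suc n} = insert (Suc n) {1..n}" by auto
  then have "v \<in> Symdiff (\<lambda>i. {g (x i)}) {1..Suc n} \<longleftrightarrow>
      (v = g (x (Suc n))) \<noteq> (v \<in> Symdiff (\<lambda>i. {g (x i)}) {1..n})"
    by (simp add: mem_symdiff_iff)
  then show ?case unfolding Suc.IH
    by (cases "x (Suc n)" rule: z3_cases) auto
qed simp

lemma z3_three: "(3::z3) = 0"
  by simp

definition pair_value :: "z3 poly \<Rightarrow> z3 \<Rightarrow> z3 \<Rightarrow> z3 \<Rightarrow> z3" where
  "pair_value p d a b = (a - b)\<^sup>2 * poly p (a + b) + d"

text \<open>For distinct \<open>a\<close>, \<open>b\<close> the squared difference is 1, and
  \<open>a + b\<close> is the negative of the third element.\<close>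

lemma pair_value_simps:
  "pair_value p d a a = d"
  "pair_value p d 0 1 = poly p 1 + d" "pair_value p d 1 0 = poly p 1 + d"
  "pair_value p d 0 2 = poly p 2 + d" "pair_value p d 2 0 = poly p 2 + d"
  "pair_value p d 1 2 = poly p 0 + d" "pair_value p d 2 1 = poly p 0 + d"
  by (simp_all add: pair_value_def power2_eq_square z3_three)

lemma pair_part_Suc:
  "pair_part (Suc n) p d x =
     pair_part n p d x \<oplus> Symdiff (\<lambda>i. {pair_value p d (x i) (x (Suc n))}) {1..n}"
proof -
  let ?P = "\<lambda>n. {(i, j). 1 \<le> i \<and> i < j \<and> j \<le> n}"
  let ?t = "\<lambda>(i, j). {(x i - x j)\<^sup>2 * poly p (x i + x j) + d}"
  have fin: "finite (?P n)"
    by (rule finite_subset[of _ "{1..n} \<times> {1..n}"]) auto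
  have "?P (Suc n) = ?P n \<union> (\<lambda>i. (i, Suc n)) ` {1..n}" by (auto simp: le_Suc_eq)
  then have "pair_part (Suc n) p d x = pair_part n p d x \<oplus> Symdiff ?t ((\<lambda>i. (i, Suc n)) ` {1..n})"
    unfolding pair_part_def using fin by (subst Symdiff.union_disjoint[symmetric]) auto
  also have "Symdiff ?t ((\<lambda>i. (i, Suc n)) ` {1..n}) =
      Symdiff (\<lambda>i. {pair_value p d (x i) (x (Suc n))}) {1..n}"
    by (subst Symdiff.reindex) (auto simp: inj_on_def o_def pair_value_def)
  finally show ?thesis .
qed

lemma pair_part_0: "pair_part 0 p d x = {}"
proof -
  have "{(i, j). 1 \<le> i \<and> i < j \<and> j \<le> (0::nat)} = {}" by auto
  then show ?thesis unfolding pair_part_def by (simp only: Symdiff.empty)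
qed

lemma odd_choose_two_Suc: "odd (Suc n choose 2) \<longleftrightarrow> odd (n choose 2) \<noteq> odd n"
proof -
  have "Suc n choose 2 = n + (n choose 2)" by (simp add: numeral_2_eq_2)
  then show ?thesis by auto
qed

text \<open>The period 4 of this parity is the origin of the four formulas.\<close>

lemma odd_choose_two: "odd (n choose 2) \<longleftrightarrow> n mod 4 = 2 \<or> n mod 4 = 3"
proof (induction n)
  case (Suc n)
  then show ?case unfolding odd_choose_two_Suc by presburger
qed (simp add: numeral_2_eq_2)

text \<open>
  With \<open>n\<^sub>a\<close> the number of occurrences of \<open>a\<close>, the singleton \<open>{d}\<close> arises from the
  \<open>\<Sum>\<^sub>a (n\<^sub>a choose 2)\<close> pairs with equal entries. The parity of this sum follows from
  \<open>n choose 2 = \<Sum>\<^sub>a (n\<^sub>a choose 2) + n\<^sub>0 n\<^sub>1 + n\<^sub>0 n\<^sub>2 + n\<^sub>1 n\<^sub>2\<close>.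
\<close>

lemma mem_pair_part:
  "v \<in> pair_part n p d x \<longleftrightarrow>
     ((par n x 0 \<and> par n x 1 \<and> (v = poly p 1 + d) \<noteq> (v = d)) \<noteq>
      (par n x 0 \<and> par n x 2 \<and> (v = poly p 2 + d) \<noteq> (v = d))) \<noteq>
     ((par n x 1 \<and> par n x 2 \<and> (v = poly p 0 + d) \<noteq> (v = d)) \<noteq>
      (odd (n choose 2) \<and> v = d))"
proof (induction n)
  case 0
  then show ?case by (simp add: pair_part_0 numeral_2_eq_2)
next
  case (Suc n)
  show ?case
    unfolding pair_part_Suc mem_symdiff_iff Suc.IH
      mem_Symdiff_values[where g = "\<lambda>a. pair_value p d a (x (Suc n))"] odd_choose_two_Suc
      odd_iff_par[of n x] par_Suc
    by (cases "x (Suc n)" rule: z3_cases; simp add: pair_value_simps; argo)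
qed

text \<open>
  Of the three parities, either all agree or exactly one differs from the other two. In the
  latter case, for even \<open>n\<close> the two values \<open>a \<noteq> b\<close> occurring an odd number of times contribute
  \<open>p(a + b)\<close>, and \<open>a + b\<close> is the negative of the remaining value.
\<close>

definition par_value :: "nat \<Rightarrow> (z3 \<Rightarrow> z3) \<Rightarrow> z3 \<Rightarrow> (nat \<Rightarrow> z3) \<Rightarrow> z3" where
  "par_value n q d x =
     (if par n x 1 = par n x 2 then if par n x 0 = par n x 1 then d else q 0 + d
      else if par n x 0 = par n x 2 then q (if even n then 2 else 1) + d
      else q (if even n then 1 else 2) + d)"

text \<open>The \<open>{d}\<close> from \<open>odd (n choose 2)\<close> and the explicit
  \<open>{d}\<close> together leave one \<open>{d}\<close> for even \<open>n\<close> and none for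
  odd \<open>n\<close>. For odd \<open>n\<close> the single part supplies the value if just one
  parity is odd, and cancels the three polynomial terms if all are odd.\<close>

lemma has_form_iff:
  "has_form n f p d \<longleftrightarrow> (\<forall>x \<in> tuples n. f x = par_value n (poly p) d x)"
proof -
  let ?pv = "\<lambda>x. {par_value n (poly p) d x}"
  have single: "v \<in> single_part n p d x \<longleftrightarrow>
      ((par n x 0 \<and> v = poly p 0 + d) \<noteq> (par n x 1 \<and> v = poly p 1 + d)) \<noteq>
      (par n x 2 \<and> v = poly p 2 + d)" for v x
    unfolding single_part_def by (rule mem_Symdiff_values)
  note mem = mem_symdiff_iff mem_pair_part single
  have mod_cases: "(even n \<longleftrightarrow> n mod 4 = 0 \<or> n mod 4 = 2)" by presburger
  have E0: "pair_part n p d x \<oplus> {d} = ?pv x" if "n mod 4 = 0" for x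
  proof (rule set_eqI)
    show "v \<in> pair_part n p d x \<oplus> {d} \<longleftrightarrow> v \<in> ?pv x" for v
      using odd_iff_par[of n x] that unfolding mem odd_choose_two mod_cases par_value_def
      by (cases "par n x 0"; cases "par n x 1"; cases "par n x 2"; simp; auto)
  qed
  have E1: "pair_part n p d x \<oplus> single_part n p d x = ?pv x" if "n mod 4 = 1" for x
  proof (rule set_eqI)
    show "v \<in> pair_part n p d x \<oplus> single_part n p d x \<longleftrightarrow> v \<in> ?pv x" for v
      using odd_iff_par[of n x] that unfolding mem odd_choose_two mod_cases par_value_def
      by (cases "par n x 0"; cases "par n x 1"; cases "par n x 2"; simp; auto)
  qed
  have E2: "pair_part n p d x = ?pv x" if "n mod 4 = 2" for x
  proof (rule set_eqI)
    show "v \<in> pair_part n p d x \<longleftrightarrow> v \<in> ?pv x" for v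
      using odd_iff_par[of n x] that unfolding mem odd_choose_two mod_cases par_value_def
      by (cases "par n x 0"; cases "par n x 1"; cases "par n x 2"; simp; auto)
  qed
  have E3: "pair_part n p d x \<oplus> single_part n p d x \<oplus> {d} = ?pv x" if "n mod 4 = 3" for x
  proof (rule set_eqI)
    show "v \<in> pair_part n p d x \<oplus> single_part n p d x \<oplus> {d} \<longleftrightarrow> v \<in> ?pv x" for v
      using odd_iff_par[of n x] that unfolding mem odd_choose_two mod_cases par_value_def
      by (cases "par n x 0"; cases "par n x 1"; cases "par n x 2"; simp; auto)
  qed
  have "n mod 4 = 0 \<or> n mod 4 = 1 \<or> n mod 4 = 2 \<or> n mod 4 = 3" by presburger
  then show ?thesis
    unfolding has_form_def by (elim disjE) (simp_all add: E0 E1 E2 E3)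
qed

section \<open>Quadratic polynomials as the functions on \<open>z3\<close>\<close>

lemma poly_quad_poly:
  "poly (quad_poly a b c) 0 = c" "poly (quad_poly a b c) 1 = a + b + c"
  "poly (quad_poly a b c) 2 = a - b + c"
proof -
  have "(2::z3) = - 1" by simp
  then show "poly (quad_poly a b c) 2 = a - b + c" by (simp add: quad_poly_def algebra_simps z3_three)
qed (simp_all add: quad_poly_def algebra_simps)

lemma quad_poly_interpolates:
  fixes g :: "z3 \<Rightarrow> z3"
  shows "\<exists>a b c. poly (quad_poly a b c) = g"
proof -
  \<comment> \<open>Solution of the equations in \<open>poly_quad_poly\<close>, using
    \<open>2 = - 1\<close>.\<close>
  let ?a = "- (g 1 + g 2 + g 0)" and ?b = "g 2 - g 1" and ?c = "g 0"
  have "poly (quad_poly ?a ?b ?c) v = g v" for v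
    by (cases v rule: z3_cases; cases "g 0" rule: z3_cases; cases "g 1" rule: z3_cases;
        cases "g 2" rule: z3_cases; simp add: poly_quad_poly)
  then show ?thesis by blast
qed

lemma quad_poly_inject:
  assumes "poly (quad_poly a b c) = poly (quad_poly a' b' c')"
  shows "a = a' \<and> b = b' \<and> c = c'"
proof -
  have c: "c = c'" and 1: "a + b = a' + b'" and 2: "a - b = a' - b'"
    using fun_cong[OF assms, of 0] fun_cong[OF assms, of 1] fun_cong[OF assms, of 2]
    by (simp_all add: poly_quad_poly)
  have "a = - ((a + b) + (a - b))" for a b :: z3
    by (cases a rule: z3_cases; simp)
  then have "a = a'" using 1 2 by metis
  then show ?thesis using c 1 by simp
qed

lemma par_value_determined:
  fixes F :: "(nat \<Rightarrow> z3) \<Rightarrow> z3"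
  assumes "\<And>x y. par n x = par n y \<Longrightarrow> F x = F y"
  shows "\<exists>q d. \<forall>x. F x = par_value n q d x"
proof -
  \<comment> \<open>Numbers the parity vectors: 3 if all parities agree, otherwise the element whose
    parity differs from the other two.\<close>
  define cls :: "(nat \<Rightarrow> z3) \<Rightarrow> nat" where
    "cls x = (if par n x 1 = par n x 2 then if par n x 0 = par n x 1 then 3 else 0
      else if par n x 0 = par n x 2 then 1 else 2)" for x
  have "par n x = par n y" if "cls x = cls y" for x y
  proof
    fix v
    show "par n x v = par n y v"
      using that odd_iff_par[of n x] odd_iff_par[of n y] unfolding cls_def
      by (cases v rule: z3_cases) (auto split: if_splits)
  qed
  then have cls: "F x = F y" if "cls x = cls y" for x y using assms that by blast
  define w where "w c = F (SOME x. cls x = c)" for c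
  have w: "F x = w (cls x)" for x
    unfolding w_def by (rule cls) (metis (mono_tags, lifting) someI)
  \<comment> \<open>Inverts \<open>par_value\<close>, which swaps classes 1 and 2 for even
    \<open>n\<close>.\<close>
  define q where "q a = (if a = 0 then w 0 else if (a = 1) = even n then w 2 else w 1) - w 3" for a :: z3
  have "F x = par_value n q (w 3) x" for x
    unfolding w cls_def par_value_def q_def by auto
  then show ?thesis by blast
qed

section \<open>The arity gap\<close>

text \<open>Makes \<open>collapses\<close> and \<open>blind\<close>, which quantify over all
  functions on \<open>nat\<close>, applicable to \<open>f\<close>, of which only the values on
  tuples matter.\<close>

definition lift :: "nat \<Rightarrow> ((nat \<Rightarrow> 'a) \<Rightarrow> 'b) \<Rightarrow> (nat \<Rightarrow> 'a) \<Rightarrow> 'b" where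
  "lift n f x = f (restrict x {1..n})"

lemma lift_tuple: "x \<in> tuples n \<Longrightarrow> lift n f x = f x"
  by (simp add: lift_def tuples_def PiE_restrict)

lemma restrict_in_tuples: "restrict x {1..n} \<in> tuples n"
  by (simp add: tuples_def)

lemma lift_cong: "(\<And>i. i \<in> {1..n} \<Longrightarrow> x i = y i) \<Longrightarrow> lift n f x = lift n f y"
  unfolding lift_def by (metis restrict_ext)

lemma Ess_subset: "Ess n f \<subseteq> {1..n}"
  by (auto simp: Ess_def)

lemma mem_Ess_iff: "i \<in> Ess n f \<longleftrightarrow> i \<in> {1..n} \<and> (\<exists>x a. lift n f (x(i := a)) \<noteq> lift n f x)"
proof (intro iffI conjI)
  assume "i \<in> Ess n f"
  then obtain x y where i: "i \<in> {1..n}" and x: "x \<in> tuples n" and y: "y \<in> tuples n"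
    and xy: "\<forall>k \<in> {1..n} - {i}. x k = y k" and ne: "f x \<noteq> f y"
    unfolding Ess_def by auto
  have "lift n f (x(i := y i)) = lift n f y"
    by (rule lift_cong) (use xy in auto)
  then show "\<exists>x a. lift n f (x(i := a)) \<noteq> lift n f x"
    using ne lift_tuple[OF x, of f] lift_tuple[OF y, of f] by metis
next
  assume "i \<in> {1..n} \<and> (\<exists>x a. lift n f (x(i := a)) \<noteq> lift n f x)"
  then obtain x a where i: "i \<in> {1..n}" and "lift n f (x(i := a)) \<noteq> lift n f x" by blast
  then show "i \<in> Ess n f"
    unfolding Ess_def lift_def mem_Collect_eq
    by (intro conjI bexI[OF _ restrict_in_tuples[of "x(i := a)"]] bexI[OF _ restrict_in_tuples[of x]])
      auto
qed (use Ess_subset in blast)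

lemma lift_ident_minor:
  assumes "i \<in> {1..n}" "j \<in> {1..n}"
  shows "lift n (ident_minor f i j) x = lift n f (x(i := x j))"
  unfolding lift_def ident_minor_def
  by (rule arg_cong[of _ _ f]) (use assms in \<open>auto simp: fun_eq_iff restrict_def\<close>)

text \<open>The arguments with \<open>x i = x j\<close> are those of the form
  \<open>x(i := x j)\<close>, the ones at which the minor evaluates \<open>f\<close>.\<close>

lemma mem_Ess_ident_minor:
  fixes f :: "(nat \<Rightarrow> 'a) \<Rightarrow> 'b"
  assumes ij: "i \<in> {1..n}" "j \<in> {1..n}" "i \<noteq> j"
  shows "i \<notin> Ess n (ident_minor f i j)"
    and "j \<in> Ess n (ident_minor f i j) \<longleftrightarrow> \<not> collapses (lift n f) i j"
    and "l \<in> {1..n} - {i, j} \<Longrightarrow> l \<in> Ess n (ident_minor f i j) \<longleftrightarrow> \<not> blind (lift n f) i j l"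
proof -
  let ?F = "lift n f"
  note minor = lift_ident_minor[OF ij(1,2)]
  show "i \<notin> Ess n (ident_minor f i j)"
    unfolding mem_Ess_iff minor using ij by simp
  have "(\<forall>x a. ?F (x(j := a, i := a)) = ?F (x(i := x j))) \<longleftrightarrow> collapses ?F i j"
  proof
    assume *: "\<forall>x a. ?F (x(j := a, i := a)) = ?F (x(i := x j))"
    show "collapses ?F i j" unfolding collapses_def
    proof (intro allI impI)
      fix x y :: "nat \<Rightarrow> 'a"
      assume x: "x i = x j" and y: "y i = y j" and xy: "\<forall>k. k \<noteq> i \<longrightarrow> k \<noteq> j \<longrightarrow> x k = y k"
      have "x(j := y j, i := y j) = y" "x(i := x j) = x" using x y xy by (auto simp: fun_eq_iff)
      then show "?F x = ?F y" using * by metis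
    qed
  next
    assume c: "collapses ?F i j"
    show "\<forall>x a. ?F (x(j := a, i := a)) = ?F (x(i := x j))"
      using ij(3) by (intro allI) (rule collapsesD[OF c]; auto)
  qed
  then show "j \<in> Ess n (ident_minor f i j) \<longleftrightarrow> \<not> collapses ?F i j"
    unfolding mem_Ess_iff minor using ij by auto
  assume l: "l \<in> {1..n} - {i, j}"
  have "(\<forall>x a. ?F (x(l := a, i := x j)) = ?F (x(i := x j))) \<longleftrightarrow> blind ?F i j l"
  proof
    assume *: "\<forall>x a. ?F (x(l := a, i := x j)) = ?F (x(i := x j))"
    show "blind ?F i j l" unfolding blind_def
    proof (intro allI impI)
      fix x y :: "nat \<Rightarrow> 'a"
      assume x: "x i = x j" and xy: "\<forall>k. k \<noteq> l \<longrightarrow> x k = y k"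
      have "x(l := y l, i := x j) = y" "x(i := x j) = x" using x xy l by (auto simp: fun_eq_iff)
      then show "?F x = ?F y" using * by metis
    qed
  next
    assume c: "blind ?F i j l"
    show "\<forall>x a. ?F (x(l := a, i := x j)) = ?F (x(i := x j))"
      using ij(3) l by (intro allI) (rule blindD[OF c]; auto)
  qed
  then show "l \<in> Ess n (ident_minor f i j) \<longleftrightarrow> \<not> blind ?F i j l"
    unfolding mem_Ess_iff minor using l by auto
qed

text \<open>Excludes differences above two when all pairs collapse. For \<open>x i = x j\<close>
  every other variable in \<open>S\<close> is inessential, so \<open>x\<close> may be zeroed on
  \<open>S\<close>. Any other equal pair can be moved to reach this case, and among four entries
  there is an equal pair.\<close>

lemma const_if_collapse_and_blind:
  fixes F :: "(nat \<Rightarrow> z3) \<Rightarrow> 'b"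
  assumes card: "card S \<ge> 4"
    and coll: "\<And>i j. i \<in> S \<Longrightarrow> j \<in> S \<Longrightarrow> i \<noteq> j \<Longrightarrow> collapses F i j"
    and ijl: "i \<in> S" "j \<in> S" "l \<in> S" "distinct [i, j, l]" and blind: "blind F i j l"
    and m: "m \<in> S"
  shows "F (x(m := a)) = F x"
proof -
  have b: "blind F i j k" if "k \<in> S - {i, j}" for k
    using blind_if_collapses[OF blind coll[of k l]] blind that ijl by (cases "k = l") auto
  have finS: "finite S" using card by (metis card.infinite not_numeral_le_zero)
  define z where "z x k = (if k \<in> S then 0 else x k)" for x :: "nat \<Rightarrow> z3" and k
  have diag: "F x = F (z x)" if x: "x i = x j" for x
  proof -
    have "F x = F (\<lambda>k. if k \<in> T then 0 else x k)" if "finite T" "T \<subseteq> S - {i, j}" for T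
      using that
    proof (induction T rule: finite_induct)
      case (insert t T)
      have "F (\<lambda>k. if k \<in> T then 0 else x k) = F (\<lambda>k. if k \<in> insert t T then 0 else x k)"
        by (rule blindD[OF b[of t]]) (use insert.prems x in auto)
      then show ?case using insert by simp
    qed simp
    from this[of "S - {i, j}"] have "F x = F (\<lambda>k. if k \<in> S - {i, j} then 0 else x k)"
      using finS by simp
    also have "\<dots> = F (z x)"
      by (rule collapsesD[OF coll[OF ijl(1,2)]]) (use ijl x in \<open>auto simp: z_def\<close>)
    finally show ?thesis .
  qed
  have z_cong: "z x = z y" if "\<And>k. k \<notin> S \<Longrightarrow> x k = y k" for x y
    using that by (auto simp: z_def fun_eq_iff)
  have via_one: "F x = F (z x)"
    if p: "p \<in> {i, j}" and q: "q \<in> S - {i, j}" and x: "x p = x q" for x p q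
  proof -
    obtain p' where p': "{p, p'} = {i, j}" "p' \<noteq> p" using p ijl by auto
    let ?y = "x(p := x p', q := x p')"
    have "F x = F ?y"
      by (rule collapsesD[OF coll[of p q]]) (use p q ijl x in auto)
    also have "\<dots> = F (z ?y)" by (rule diag) (use p p' q ijl in auto)
    also have "z ?y = z x" by (rule z_cong) (use p q ijl in auto)
    finally show ?thesis .
  qed
  have via_two: "F x = F (z x)"
    if q: "q \<in> S - {i, j}" "r \<in> S - {i, j}" "q \<noteq> r" and x: "x q = x r" for x q r
  proof -
    let ?y = "x(q := x i, r := x i)"
    have "F x = F ?y"
      by (rule collapsesD[OF coll[of q r]]) (use q x in auto)
    also have "\<dots> = F (z ?y)" by (rule via_one[of i q]) (use q in auto)
    also have "z ?y = z x" by (rule z_cong) (use q in auto)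
    finally show ?thesis .
  qed
  have "card {i, j, l} < card S" using card by (simp add: card_insert_if)
  then obtain k where k: "k \<in> S" "k \<notin> {i, j, l}"
    using card_mono[of "{i, j, l}" S] by (meson finite.emptyI finite_insert leD subsetI)
  have all: "F x = F (z x)" for x
    using z3_pigeonhole[of "x i" "x j" "x k" "x l"]
  proof (elim disjE)
    assume "x i = x j" then show ?thesis by (rule diag)
  next
    assume "x i = x k" then show ?thesis by (intro via_one[of i k]) (use k in auto)
  next
    assume "x i = x l" then show ?thesis by (intro via_one[of i l]) (use ijl in auto)
  next
    assume "x j = x k" then show ?thesis by (intro via_one[of j k]) (use k in auto)
  next
    assume "x j = x l" then show ?thesis by (intro via_one[of j l]) (use ijl in auto)
  next
    assume "x k = x l" then show ?thesis by (intro via_two[of k l]) (use k ijl in auto)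
  qed
  have "z (x(m := a)) = z x" by (rule z_cong) (use m in auto)
  then show ?thesis using all[of x] all[of "x(m := a)"] by simp
qed

text \<open>A gap of at least two already forces all pairs to collapse, and then every difference is
  exactly two. Since differences are at least one, any other gap is one.\<close>

lemma arity_gap_characterization:
  fixes f :: "(nat \<Rightarrow> z3) \<Rightarrow> 'b"
  assumes n: "n \<ge> 4" and Ess: "Ess n f = {1..n}"
  shows "arity_gap n f = 2 \<longleftrightarrow> (\<forall>i \<in> {1..n}. \<forall>j \<in> {1..n}. i \<noteq> j \<longrightarrow> collapses (lift n f) i j)"
    and "arity_gap n f \<noteq> 2 \<Longrightarrow> arity_gap n f = 1"
proof -
  let ?F = "lift n f"
  let ?diff = "\<lambda>i j. int n - int (ess n (ident_minor f i j))"
  let ?G = "{?diff i j | i j. i \<in> {1..n} \<and> j \<in> {1..n} \<and> i \<noteq> j}"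
  let ?coll = "\<forall>i \<in> {1..n}. \<forall>j \<in> {1..n}. i \<noteq> j \<longrightarrow> collapses ?F i j"
  have gap: "arity_gap n f = Min ?G"
    unfolding arity_gap_def ess_def Ess by simp
  have "?G = (\<lambda>(i, j). ?diff i j) ` {(i, j). i \<in> {1..n} \<and> j \<in> {1..n} \<and> i \<noteq> j}" by auto
  moreover have "finite {(i, j). i \<in> {1..n} \<and> j \<in> {1..n} \<and> i \<noteq> j}"
    by (rule finite_subset[of _ "{1..n} \<times> {1..n}"]) auto
  ultimately have fin: "finite ?G" by simp
  have "?diff 1 2 \<in> ?G" using n by force
  then have ne: "?G \<noteq> {}" by blast
  have ess: "\<exists>x a. ?F (x(l := a)) \<noteq> ?F x" if "l \<in> {1..n}" for l
    using that Ess mem_Ess_iff[of l n f] by blast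
  have minor_sub: "Ess n (ident_minor f i j) \<subseteq> {1..n} - {i}"
    if "i \<in> {1..n}" "j \<in> {1..n}" "i \<noteq> j" for i j
    using Ess_subset mem_Ess_ident_minor(1)[OF that] by blast
  have ge1: "?diff i j \<ge> 1" if "i \<in> {1..n}" "j \<in> {1..n}" "i \<noteq> j" for i j
  proof -
    have "ess n (ident_minor f i j) \<le> card ({1..n} - {i})"
      unfolding ess_def by (rule card_mono[OF _ minor_sub[OF that]]) simp
    then have "ess n (ident_minor f i j) \<le> n - 1" using that by simp
    then show ?thesis using n by linarith
  qed
  have coll: ?coll if "arity_gap n f \<ge> 2"
  proof -
    have "gap_at_least_two ?F {1..n}"
    proof
      fix i j assume ij: "i \<in> {1..n}" "j \<in> {1..n}" "i \<noteq> j"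
      have "?diff i j \<ge> 2" using that ij unfolding gap Min_ge_iff[OF fin ne] by blast
      then have "card (Ess n (ident_minor f i j)) < card ({1..n} - {i})"
        unfolding ess_def using ij by simp
      then have "Ess n (ident_minor f i j) \<noteq> {1..n} - {i}" by (metis less_irrefl)
      \<comment> \<open>The missing \<open>l\<close> is the merged variable \<open>j\<close>, so
        that the pair collapses, or it is a blind variable.\<close>
      then obtain l where "l \<in> {1..n} - {i}" "l \<notin> Ess n (ident_minor f i j)"
        using minor_sub[OF ij] by blast
      then show "collapses ?F i j \<or> (\<exists>l \<in> {1..n} - {i, j}. blind ?F i j l)"
        using mem_Ess_ident_minor(2)[OF ij, of f] mem_Ess_ident_minor(3)[OF ij, of l f]
        by (cases "l = j") blast+
    qed (use n ess in auto)
    then show ?thesis using all_collapse[of ?F "{1..n}"] by blast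
  qed
  have eq2: "arity_gap n f = 2" if ?coll
  proof -
    have "?diff i j = 2" if ij: "i \<in> {1..n}" "j \<in> {1..n}" "i \<noteq> j" for i j
    proof -
      have "\<not> blind ?F i j l" if "l \<in> {1..n} - {i, j}" for l
      proof
        assume blind: "blind ?F i j l"
        have "?F (x(1 := a)) = ?F x" for x a
          by (rule const_if_collapse_and_blind[of "{1..n}" ?F i j l])
            (use blind \<open>?coll\<close> n ij that in auto)
        then show False using ess[of 1] n by auto
      qed
      then have "Ess n (ident_minor f i j) = {1..n} - {i, j}"
        using mem_Ess_ident_minor[OF ij] minor_sub[OF ij] \<open>?coll\<close> ij by blast
      then have "ess n (ident_minor f i j) = n - 2"
        unfolding ess_def using ij by (simp add: card_Diff_subset)
      then show ?thesis using n by simp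
    qed
    then have "?G \<subseteq> {2}" by blast
    then have "?G = {2}" using ne by (meson subset_singletonD)
    then show ?thesis unfolding gap by simp
  qed
  show "arity_gap n f = 2 \<longleftrightarrow> ?coll"
  proof
    assume "arity_gap n f = 2"
    then have "arity_gap n f \<ge> 2" by simp
    then show ?coll by (rule coll)
  qed (rule eq2)
  have "arity_gap n f \<ge> 1" unfolding gap Min_ge_iff[OF fin ne] using ge1 by blast
  moreover have "\<not> arity_gap n f \<ge> 2" if "arity_gap n f \<noteq> 2"
    using that coll eq2 by blast
  ultimately show "arity_gap n f = 1" if "arity_gap n f \<noteq> 2"
    using that by linarith
qed

section \<open>Existence and uniqueness of the polynomial form\<close>

lemma par_value_cong: "par n x = par n y \<Longrightarrow> par_value n q d x = par_value n q d y"
  by (simp add: par_value_def)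

lemma par_value_rep:
  assumes "n \<ge> 2"
  shows "par_value n q d (rep 0 0) = (if even n then d else q 0 + d)"
    and "par_value n q d (rep 1 2) = (if even n then q 0 + d else d)"
    and "par_value n q d (rep 1 0) = q 1 + d"
    and "par_value n q d (rep 2 0) = q 2 + d"
  by (auto simp: par_value_def par_rep[OF assms])

text \<open>The four representatives reveal \<open>d\<close> and the three values of
  \<open>q\<close>. As \<open>rep\<close> need not lie in \<open>tuples n\<close>, the equality is
  first extended to all functions.\<close>

lemma par_value_inject:
  assumes n: "n \<ge> 2" and eq: "\<And>x. x \<in> tuples n \<Longrightarrow> par_value n q d x = par_value n q' d' x"
  shows "q = q' \<and> d = d'"
proof -
  have restrict: "par_value n r c (restrict x {1..n}) = par_value n r c x" for r c x
    by (rule par_value_cong, rule par_cong) simp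
  have "par_value n q d x = par_value n q' d' x" for x
    using eq[OF restrict_in_tuples[of x n]] unfolding restrict .
  note vals = this[of "rep 0 0"] this[of "rep 1 2"] this[of "rep 1 0"] this[of "rep 2 0"]
  have d: "d = d'" using vals(1,2) unfolding par_value_rep[OF n] by (cases "even n") simp_all
  have "q v = q' v" for v
    using vals unfolding par_value_rep[OF n] d
    by (cases "even n"; cases v rule: z3_cases) simp_all
  then show ?thesis using d by blast
qed

lemma has_form_iff_lift:
  "has_form n f p d \<longleftrightarrow> (\<forall>x. lift n f x = par_value n (poly p) d x)"
proof
  assume form: "has_form n f p d"
  show "\<forall>x. lift n f x = par_value n (poly p) d x"
  proof
    fix x :: "nat \<Rightarrow> z3"
    have "par n (restrict x {1..n}) = par n x" by (rule par_cong) simp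
    then show "lift n f x = par_value n (poly p) d x"
      using form restrict_in_tuples[of x n] par_value_cong
      unfolding has_form_iff lift_def by metis
  qed
next
  assume "\<forall>x. lift n f x = par_value n (poly p) d x"
  then show "has_form n f p d"
    unfolding has_form_iff by (metis lift_tuple)
qed

lemma ex_form_iff_collapses:
  assumes n: "n \<ge> 4"
  shows "(\<exists>a b c d. has_form n f (quad_poly a b c) d) \<longleftrightarrow>
    (\<forall>i \<in> {1..n}. \<forall>j \<in> {1..n}. i \<noteq> j \<longrightarrow> collapses (lift n f) i j)"
proof
  assume "\<exists>a b c d. has_form n f (quad_poly a b c) d"
  then obtain q d where F: "\<And>x. lift n f x = par_value n q d x"
    unfolding has_form_iff_lift by blast
  have "collapses (lift n f) i j" if "i \<in> {1..n}" "j \<in> {1..n}" "i \<noteq> j" for i j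
  proof -
    have "collapses (par n :: (nat \<Rightarrow> z3) \<Rightarrow> z3 \<Rightarrow> bool) i j" by (rule collapses_par[OF that])
    then show ?thesis unfolding collapses_def F using par_value_cong by metis
  qed
  then show "\<forall>i \<in> {1..n}. \<forall>j \<in> {1..n}. i \<noteq> j \<longrightarrow> collapses (lift n f) i j" by blast
next
  assume coll: "\<forall>i \<in> {1..n}. \<forall>j \<in> {1..n}. i \<noteq> j \<longrightarrow> collapses (lift n f) i j"
  have "lift n f x = lift n f y" if "par n x = par n y" for x y :: "nat \<Rightarrow> z3"
    by (rule par_determines[OF n _ _ that]) (use coll lift_cong in blast)+
  then obtain q d where "\<forall>x. lift n f x = par_value n q d x"
    using par_value_determined by metis
  moreover obtain a b c where "poly (quad_poly a b c) = q" using quad_poly_interpolates by metis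
  ultimately show "\<exists>a b c d. has_form n f (quad_poly a b c) d"
    unfolding has_form_iff_lift by metis
qed

lemma has_form_unique:
  assumes n: "n \<ge> 2"
    and "has_form n f (quad_poly a b c) d" "has_form n f (quad_poly a' b' c') d'"
  shows "(a, b, c, d) = (a', b', c', d')"
proof -
  have "poly (quad_poly a b c) = poly (quad_poly a' b' c') \<and> d = d'"
    by (rule par_value_inject[OF n]) (use assms(2,3) in \<open>simp add: has_form_iff\<close>)
  then show ?thesis using quad_poly_inject by blast
qed

theorem theorem5p1:
  fixes n :: nat and f :: "(nat \<Rightarrow> z3) \<Rightarrow> z3"
  assumes "n \<ge> 4" and "Ess n f = {1..n}"
  shows "(arity_gap n f = 2 \<longleftrightarrow> (\<exists>a b c d. has_form n f (quad_poly a b c) d))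
    \<and> (arity_gap n f = 2 \<longrightarrow> (\<exists>!(a, b, c, d). has_form n f (quad_poly a b c) d))
    \<and> (arity_gap n f \<noteq> 2 \<longrightarrow> arity_gap n f = 1)"
proof (intro conjI impI)
  show iff: "arity_gap n f = 2 \<longleftrightarrow> (\<exists>a b c d. has_form n f (quad_poly a b c) d)"
    unfolding arity_gap_characterization(1)[OF assms] ex_form_iff_collapses[OF assms(1)] ..
  show "\<exists>!(a, b, c, d). has_form n f (quad_poly a b c) d" if gap: "arity_gap n f = 2"
  proof -
    obtain a b c d where form: "has_form n f (quad_poly a b c) d" using gap iff by blast
    have "n \<ge> 2" using assms(1) by simp
    show ?thesis
    proof (rule ex1I[of _ "(a, b, c, d)"])
      show "t = (a, b, c, d)" if "case t of (a, b, c, d) \<Rightarrow> has_form n f (quad_poly a b c) d" for t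
        using that has_form_unique[OF \<open>n \<ge> 2\<close> _ form] by (cases t) simp
    qed (use form in simp)
  qed
  show "arity_gap n f = 1" if "arity_gap n f \<noteq> 2"
    by (rule arity_gap_characterization(2)[OF assms that])
qed

end
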